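(* Let $N\ge 2$, let $\lambda,\mu$ be parameters, and let $\psi(\xi;\nu)=\int_0^\xi\log(e^\eta+\nu)\,d\eta$. For $y,z\in\mathbb{R}^N$ define, in the periodic case (indices modulo $N$), $$\Lambda(y,z;\nu)=\sum_{k=1}^N\psi(z_k-y_k;-1)-\sum_{k=1}^N\psi(y_{k+1}-z_k;\nu),$$ and in the open-end case $$\Lambda(y,z;\nu)=\sum_{k=1}^N\psi(z_k-y_k;-1)-\sum_{k=1}^{N-1}\psi(y_{k+1}-z_k;\nu)+(z_N-y_1)\log\nu.$$ Let $x,\widetilde{x},\widehat{x},\widehat{\widetilde{x}}\in\mathbb{R}^N$ (with all logarithms defined) satisfy for all $k=1,\dots,N$ the corner equations $$(E)\ \big(e^{\widetilde{x}_k-x_k}-1\big)\big(\lambda+e^{x_k-\widetilde{x}_{k-1}}\big)=\big(e^{\widehat{x}_k-x_k}-1\big)\big(\mu+e^{x_k-\widehat{x}_{k-1}}\big),$$ $$(E_1)\ \big(e^{\widetilde{x}_k-x_k}-1\big)\big(\lambda+e^{x_{k+1}-\widetilde{x}_k}\big)=\big(e^{\widehat{\widetilde{x}}_k-\widetilde{x}_k}-1\big)\big(\mu+e^{\widetilde{x}_k-\widehat{\widetilde{x}}_{k-1}}\big),$$ $$(E_2)\ \big(e^{\widehat{x}_k-x_k}-1\big)\big(\mu+e^{x_{k+1}-\widehat{x}_k}\big)=\big(e^{\widehat{\widetilde{x}}_k-\widehat{x}_k}-1\big)\big(\lambda+e^{\widehat{x}_k-\widehat{\widetilde{x}}_{k-1}}\big),$$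 $$(E_{12})\ \big(e^{\widehat{\widetilde{x}}_k-\widehat{x}_k}-1\big)\big(\lambda+e^{\widehat{x}_{k+1}-\widehat{\widetilde{x}}_k}\big)=\big(e^{\widehat{\widetilde{x}}_k-\widetilde{x}_k}-1\big)\big(\mu+e^{\widetilde{x}_{k+1}-\widehat{\widetilde{x}}_k}\big),$$ where in the periodic case indices are modulo $N$, and in the open-end case every exponential whose exponent contains a field evaluated at index $0$ or $N+1$ is set equal to $0$. Then (in both cases) $$\Lambda(x,\widetilde{x};\lambda)+\Lambda(\widetilde{x},\widehat{\widetilde{x}};\mu)-\Lambda(x,\widehat{x};\mu)-\Lambda(\widehat{x},\widehat{\widetilde{x}};\lambda)=0,$$ i.e. the discrete multi-time Lagrangian 1-form is closed on any solution of the corner equations.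
   Context: $\Lambda(\cdot,\cdot;\nu)$ is the generating function ($p=-\partial\Lambda/\partial x$, $\widetilde p=\partial\Lambda/\partial\widetilde x$) of the Bäcklund transformation $F_\nu$ of the modified Toda lattice $\ddot x_k=\dot x_k(e^{x_{k+1}-x_k}-e^{x_k-x_{k-1}})$, given by $e^{p_k}=(e^{\widetilde x_k-x_k}-1)(\nu+e^{x_k-\widetilde x_{k-1}})$, $e^{\widetilde p_k}=(e^{\widetilde x_k-x_k}-1)(\nu+e^{x_{k+1}-\widetilde x_k})$. The open-end case corresponds formally to $x_0=+\infty$, $x_{N+1}=-\infty$ for all fields. *)

theory Defs
  imports "HOL-Analysis.Analysis"
begin

text \<open>Boundary conditions: periodic (indices mod N) or open-end
  (formally x_0 = +infinity, x_{N+1} = -infinity).\<close>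
datatype bc = Periodic | OpenEnd

text \<open>Fields are functions int => real; only the values at indices 1..N matter.
  Periodic reduction of an index into {1..N}.\<close>
definition pidx :: "nat \<Rightarrow> int \<Rightarrow> int" where
  "pidx N j = (j - 1) mod int N + 1"

definition psi :: "real \<Rightarrow> real \<Rightarrow> real" where
  "psi \<xi> \<nu> = (LBINT \<eta>=ereal 0..ereal \<xi>. ln (exp \<eta> + \<nu>))"

text \<open>The logarithm in the integrand of psi(xi;nu) is defined on the integration
  range (the endpoint 0 is allowed to be singular, as for nu = -1).\<close>
definition psi_ok :: "real \<Rightarrow> real \<Rightarrow> bool" where
  "psi_ok \<xi> \<nu> = (\<forall>\<eta> \<in> {min 0 \<xi>..max 0 \<xi>} - {0}. exp \<eta> + \<nu> > 0)"

definition ExpD :: "bc \<Rightarrow> nat \<Rightarrow> (int \<Rightarrow> real) \<Rightarrow> int \<Rightarrow> (int \<Rightarrow> real) \<Rightarrow> int \<Rightarrow> real" where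
  "ExpD b N u j v i = (case b of
      Periodic \<Rightarrow> exp (u (pidx N j) - v (pidx N i))
    | OpenEnd \<Rightarrow> (if 1 \<le> j \<and> j \<le> int N \<and> 1 \<le> i \<and> i \<le> int N
                  then exp (u j - v i) else 0))"

definition Lam :: "bc \<Rightarrow> nat \<Rightarrow> (int \<Rightarrow> real) \<Rightarrow> (int \<Rightarrow> real) \<Rightarrow> real \<Rightarrow> real" where
  "Lam b N y z \<nu> = (case b of
      Periodic \<Rightarrow> (\<Sum>k=1..int N. psi (z k - y k) (-1))
                  - (\<Sum>k=1..int N. psi (y (pidx N (k+1)) - z k) \<nu>)
    | OpenEnd \<Rightarrow> (\<Sum>k=1..int N. psi (z k - y k) (-1))
                  - (\<Sum>k=1..int N - 1. psi (y (k+1) - z k) \<nu>)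
                  + (z (int N) - y 1) * ln \<nu>)"

definition Lam_ok :: "bc \<Rightarrow> nat \<Rightarrow> (int \<Rightarrow> real) \<Rightarrow> (int \<Rightarrow> real) \<Rightarrow> real \<Rightarrow> bool" where
  "Lam_ok b N y z \<nu> = (case b of
      Periodic \<Rightarrow> (\<forall>k\<in>{1..int N}. psi_ok (z k - y k) (-1))
                  \<and> (\<forall>k\<in>{1..int N}. psi_ok (y (pidx N (k+1)) - z k) \<nu>)
    | OpenEnd \<Rightarrow> (\<forall>k\<in>{1..int N}. psi_ok (z k - y k) (-1))
                  \<and> (\<forall>k\<in>{1..int N - 1}. psi_ok (y (k+1) - z k) \<nu>)
                  \<and> \<nu> > 0)"

end

theory Submission
  imports Defs "HOL-Real_Asymp.Real_Asymp"
begin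

text \<open>
  Write $X, T, H, Q$ for the exponentials of $x, \widetilde x, \widehat x, \widehat{\widetilde x}$.
  Equation $(E)$ at site $k+1$ and $(E_{12})$ at site $k$, together with the positivity of the
  arguments of the logarithms, force the superposition formulas
  $(\lambda Q_k + X_{k+1})(T_{k+1} - X_{k+1}) = (\mu Q_k + X_{k+1})(H_{k+1} - X_{k+1})$ and
  $(\lambda Q_k + X_{k+1})(\mu + X_{k+1}/H_k) = (\mu Q_k + X_{k+1})(\lambda + X_{k+1}/T_k)$.
  For fixed $X_{k+1}, Q_k$ each of them describes a curve of pairs, and the reflection
  $(T_k, H_k) \mapsto (X_{k+1} Q_k / H_k, X_{k+1} Q_k / T_k)$ maps the second curve to the first.
  Along the curve the sum of the legs of the Lagrangian changes exactly as a function $-D$ of the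
  diagonal $\widetilde x - \widehat x$. Hence the terms of the closure relation that belong to the
  pair $(k, k+1)$ add up to
  $D(\widetilde x_k - \widehat x_k) - D(\widetilde x_{k+1} - \widehat x_{k+1})$,
  and the sum over $k$ telescopes. At an open end the sites $N$ and $1$ are joined in the same
  way by a degenerate pair of equations, so that the sum is cyclic in both cases.
\<close>

subsection \<open>The function psi\<close>

text \<open>The fundamental theorem of calculus lives on compact intervals. Since \<open>J\<close>
  is open and convex, it contains one with both \<open>c\<close> and \<open>s\<close> in its
  interior, on which the derivative at \<open>s\<close> is two-sided; \<open>s\<close> may lie on
  either side of \<open>c\<close>.\<close>

lemma LBINT_has_real_derivative:
  fixes f :: "real \<Rightarrow> real"
  assumes "open J" "is_interval J" "c \<in> J" "s \<in> J" "continuous_on J f"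
  shows "((\<lambda>u. LBINT y=ereal c..ereal u. f y) has_real_derivative f s) (at s)"
proof -
  have "min c s \<in> J" "max c s \<in> J"
    using assms by (auto simp: min_def max_def)
  then obtain d e where d: "d > 0" "cball (min c s) d \<subseteq> J" and e: "e > 0" "cball (max c s) e \<subseteq> J"
    using \<open>open J\<close> open_contains_cball by metis
  define a b where "a = min c s - d" and "b = max c s + e"
  have ab: "a < c" "a < s" "c < b" "s < b"
    using d e by (auto simp: a_def b_def min_def max_def)
  have "a \<in> J" "b \<in> J"
    using d e by (auto simp: a_def b_def cball_def dist_real_def)
  then have "{a..b} \<subseteq> J"
    using mem_is_interval_1_I[OF \<open>is_interval J\<close>] by (meson atLeastAtMost_iff subsetI)
  then have "continuous_on {a..b} f"
    using assms(5) continuous_on_subset by blast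
  then have "((\<lambda>u. LBINT y=ereal c..ereal u. f y) has_vector_derivative f s) (at s within {a..b})"
    using ab by (intro interval_integral_FTC2) auto
  then show ?thesis
    using ab by (simp add: at_within_Icc_at has_real_derivative_iff_has_vector_derivative)
qed

text \<open>For \<open>\<nu> > -1\<close> the base point 0 lies in the upward closed set on which
  the integrand is continuous.\<close>

lemma psi_has_real_derivative:
  assumes "\<nu> > -1" "exp \<xi> + \<nu> > 0"
  shows "((\<lambda>\<xi>. psi \<xi> \<nu>) has_real_derivative ln (exp \<xi> + \<nu>)) (at \<xi>)"
proof -
  let ?J = "{s::real. exp s + \<nu> > 0}"
  have "open ?J"
    by (intro open_Collect_less continuous_intros)
  moreover have "is_interval ?J"
  proof (clarsimp simp: is_interval_1)
    fix a x :: real assume "0 < exp a + \<nu>" "a \<le> x"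
    then show "0 < exp x + \<nu>"
      using exp_le_cancel_iff[of a x] by linarith
  qed
  moreover have "continuous_on ?J (\<lambda>s. ln (exp s + \<nu>))"
    by (intro continuous_intros) auto
  ultimately show ?thesis
    unfolding psi_def using assms by (intro LBINT_has_real_derivative) auto
qed

lemma psi_0 [simp]: "psi 0 \<nu> = 0"
  by (simp add: psi_def zero_ereal_def[symmetric])

text \<open>The integrand is split as \<open>ln s + ln ((exp s - 1) / s)\<close>, where the second summand
  extends continuously to \<open>s = 0\<close>.\<close>

lemma psi_neg1_formula:
  obtains G :: "real \<Rightarrow> real"
  where "\<And>\<xi>. \<xi> > 0 \<Longrightarrow> (G has_real_derivative ln ((exp \<xi> - 1) / \<xi>)) (at \<xi>)"
    and "continuous_on UNIV G"
    and "\<And>\<xi>. \<xi> \<ge> 0 \<Longrightarrow> psi \<xi> (-1) = \<xi> * ln \<xi> - \<xi> + G \<xi>"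
proof -
  define r where "r = (\<lambda>s::real. if s = 0 then 1 else (exp s - 1) / s)"
  have r_pos: "r s > 0" for s
    by (auto simp: r_def divide_simps)
  have "isCont r s" for s
  proof (cases "s = 0")
    case True
    have "((\<lambda>h. (exp (0 + h) - exp 0) / h) \<longlongrightarrow> exp (0::real)) (at 0)"
      using DERIV_exp[of "0::real"] by (simp add: DERIV_def)
    then have "((\<lambda>h::real. (exp h - 1) / h) \<longlongrightarrow> 1) (at 0)"
      by simp
    then have "(r \<longlongrightarrow> 1) (at 0)"
      by (rule Lim_transform_eventually) (auto simp: r_def eventually_at_filter)
    then show ?thesis
      using True by (simp add: isCont_def r_def)
  next
    case False
    have "isCont (\<lambda>s. (exp s - 1) / s) s"
      using False by (intro continuous_intros)
    moreover have "\<forall>\<^sub>F y in nhds s. (exp y - 1) / y = r y"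
      using t1_space_nhds[OF False] by (rule eventually_mono) (auto simp: r_def)
    ultimately show ?thesis
      using isCont_cong by fastforce
  qed
  then have r_cont: "continuous_on UNIV r"
    by (simp add: continuous_on_eq_continuous_at)
  let ?g = "\<lambda>s. ln (r s)"
  have g_cont: "continuous_on S ?g" for S
    using r_pos by (intro continuous_on_ln continuous_on_subset[OF r_cont]) (auto simp: less_imp_neq[symmetric])
  define G where "G = (\<lambda>\<xi>. LBINT s=ereal 0..ereal \<xi>. ?g s)"
  have G: "(G has_real_derivative ?g \<xi>) (at \<xi>)" for \<xi>
    unfolding G_def by (rule LBINT_has_real_derivative[of UNIV]) (auto intro: g_cont)
  show thesis
  proof
    show "(G has_real_derivative ln ((exp \<xi> - 1) / \<xi>)) (at \<xi>)" if "\<xi> > 0" for \<xi>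
      using G[of \<xi>] that by (simp add: r_def)
    show "continuous_on UNIV G"
      using G DERIV_continuous continuous_at_imp_continuous_on by blast
    show "psi \<xi> (-1) = \<xi> * ln \<xi> - \<xi> + G \<xi>" if "\<xi> \<ge> 0" for \<xi>
    proof (cases "\<xi> = 0")
      case True
      then show ?thesis by (simp add: G_def zero_ereal_def[symmetric])
    next
      case False
      with that have pos: "\<xi> > 0" by simp
      \<comment> \<open>The constant \<open>ln \<xi>\<close> makes \<open>?f\<close> nonnegative on
        the integration range, as the improper fundamental theorem for nonnegative integrands
        requires. The antiderivative \<open>?F\<close> tends to 0 at 0 and to \<open>\<xi>\<close>
        at \<open>\<xi>\<close>.\<close>
      let ?f = "\<lambda>s. ln \<xi> - ln s" and ?F = "\<lambda>s. s * ln \<xi> - s * ln s + s"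
      have F0: "((\<lambda>s::real. ?F s) \<longlongrightarrow> 0) (at_right 0)"
        by real_asymp
      have F1: "((?F \<circ> real_of_ereal) \<longlongrightarrow> 0) (at_right (ereal 0))"
        using F0 by (simp add: ereal_tendsto_simps)
      have "isCont ?F \<xi>"
        using pos by (intro continuous_intros) auto
      then have "(?F \<longlongrightarrow> ?F \<xi>) (at_left \<xi>)"
        by (simp add: isCont_def filterlim_at_split)
      then have F2: "((?F \<circ> real_of_ereal) \<longlongrightarrow> \<xi>) (at_left (ereal \<xi>))"
        by (simp add: ereal_tendsto_simps)
      have F3: "DERIV ?F s :> ?f s" if "ereal 0 < ereal s" for s
        using that by (auto intro!: derivative_eq_intros)
      have F4: "isCont ?f s" if "ereal 0 < ereal s" for s
        using that by (intro continuous_intros) auto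
      have F5: "AE s in lborel. ereal 0 < ereal s \<longrightarrow> ereal s < ereal \<xi> \<longrightarrow> 0 \<le> ?f s"
        by auto
      have lt: "ereal 0 < ereal \<xi>"
        using pos by simp
      note FTC = interval_integral_FTC_nonneg[OF lt F3 F4 F5 F1 F2]
      have int_f: "interval_lebesgue_integrable lborel (ereal 0) (ereal \<xi>) ?f"
        using FTC(1) pos by (simp add: interval_lebesgue_integrable_def)
      have int_h: "interval_lebesgue_integrable lborel (ereal 0) (ereal \<xi>) (\<lambda>s. ln \<xi> + ?g s)"
        by (rule interval_integrable_continuous_on) (use pos in \<open>auto intro!: continuous_intros g_cont\<close>)
      have int_g: "interval_lebesgue_integrable lborel (ereal 0) (ereal \<xi>) ?g"
        by (rule interval_integrable_continuous_on) (use pos in \<open>auto intro!: g_cont\<close>)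
      have "psi \<xi> (-1) = (LBINT s=ereal 0..ereal \<xi>. (ln \<xi> + ?g s) - ?f s)"
        unfolding psi_def
        by (rule interval_integral_cong)
          (use pos in \<open>auto simp: einterval_def r_def ln_div\<close>)
      also have "\<dots> = (LBINT s=ereal 0..ereal \<xi>. ln \<xi> + ?g s) - \<xi>"
        using interval_lebesgue_integral_diff(2)[OF int_h int_f] FTC(2) by simp
      also have "(LBINT s=ereal 0..ereal \<xi>. ln \<xi> + ?g s) = \<xi> * ln \<xi> + G \<xi>"
        unfolding G_def by (subst interval_lebesgue_integral_add(2)[OF _ int_g]) auto
      finally show ?thesis by simp
    qed
  qed
qed

text \<open>The integrand is singular at the base point 0, so the decomposition is differentiated
  instead: the slope \<open>ln \<xi>\<close> of \<open>\<xi> * ln \<xi> - \<xi>\<close> cancels the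
  denominator in the slope of \<open>G\<close>.\<close>

lemma psi_neg1_has_real_derivative:
  assumes "\<xi> > 0"
  shows "((\<lambda>\<xi>. psi \<xi> (-1)) has_real_derivative ln (exp \<xi> - 1)) (at \<xi>)"
proof -
  obtain G where G: "(G has_real_derivative ln ((exp \<xi> - 1) / \<xi>)) (at \<xi>)"
    and eq: "\<And>\<xi>. \<xi> \<ge> 0 \<Longrightarrow> psi \<xi> (-1) = \<xi> * ln \<xi> - \<xi> + G \<xi>"
    using psi_neg1_formula assms by metis
  have "((\<lambda>\<xi>. \<xi> * ln \<xi> - \<xi> + G \<xi>) has_real_derivative ln (exp \<xi> - 1)) (at \<xi>)"
    using assms by (auto intro!: derivative_eq_intros G simp: ln_div)
  moreover have "\<forall>\<^sub>F s in nhds \<xi>. psi s (-1) = s * ln s - s + G s"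
    using eventually_nhds_in_open[of "{0<..}" \<xi>] assms by (auto elim!: eventually_mono intro: eq)
  ultimately show ?thesis
    using DERIV_cong_ev[OF refl _ refl] by metis
qed

lemma continuous_on_psi_neg1: "continuous_on {0..} (\<lambda>\<xi>. psi \<xi> (-1))"
proof -
  obtain G where G: "continuous_on UNIV G"
    and eq: "\<And>\<xi>. \<xi> \<ge> 0 \<Longrightarrow> psi \<xi> (-1) = \<xi> * ln \<xi> - \<xi> + G \<xi>"
    using psi_neg1_formula by metis
  have "continuous (at s within {0..}) (\<lambda>s. s * ln s)" if "s \<ge> 0" for s :: real
  proof (cases "s = 0")
    case True
    have "((\<lambda>s::real. s * ln s) \<longlongrightarrow> 0) (at_right 0)"
      by real_asymp
    then show ?thesis
      using True by (simp add: continuous_within at_within_Ici_at_right)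
  next
    case False
    then show ?thesis
      by (intro continuous_intros) auto
  qed
  then have "continuous_on {0..} (\<lambda>s::real. s * ln s)"
    by (auto simp: continuous_on_eq_continuous_within)
  then have "continuous_on {0..} (\<lambda>s. s * ln s - s + G s)"
    by (intro continuous_on_add continuous_on_diff continuous_on_id continuous_on_subset[OF G]) auto
  then show ?thesis
    by (rule continuous_on_eq) (auto simp: eq)
qed

subsection \<open>Closure on a single pair of superposition formulas\<close>

text \<open>Eliminating \<open>\<beta>\<close> leaves a product whose first factor is positive.
  Hence \<open>b * d = a * c\<close>, the cross terms cancel, and both equations become the linear
  superposition formulas.\<close>

lemma quad_algebra:
  fixes \<alpha> \<beta> a b c d :: real
  assumes "\<alpha> + a > 0" "d \<ge> 0"
    and "a * (\<beta> + c) = b * (\<alpha> + d)" "d * (\<beta> + b) = c * (\<alpha> + a)"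
  shows "\<beta> * a = \<alpha> * b" "\<beta> * d = \<alpha> * c"
proof -
  have "(\<alpha> + a + d) * (b * d - a * c) = 0"
    using assms(3,4) by algebra
  then have "b * d = a * c"
    using assms(1,2) by simp
  then show "\<beta> * a = \<alpha> * b" "\<beta> * d = \<alpha> * c"
    using assms(3,4) by (auto simp: algebra_simps)
qed

text \<open>The two logarithms at \<open>t\<close> differ by \<open>ln r\<close>, and so do those at
  \<open>h\<close> with the same \<open>r\<close>. What remains is
  \<open>- ln r * (t' - h')\<close>, which the derivative of \<open>D\<close> along the diagonal
  cancels.\<close>

lemma leg_sum_has_derivative_0:
  fixes x r :: real and t h M L D :: "real \<Rightarrow> real"
  assumes t: "(t has_real_derivative t') (at \<epsilon>)" and h: "(h has_real_derivative h') (at \<epsilon>)"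
    and M: "(M has_real_derivative ln (r * (exp (t \<epsilon> - x) - 1))) (at (t \<epsilon>))"
    and L: "(L has_real_derivative ln (r * (exp (h \<epsilon> - x) - 1))) (at (h \<epsilon>))"
    and D: "(D has_real_derivative ln r) (at (t \<epsilon> - h \<epsilon>))"
    and pos: "t \<epsilon> > x" "h \<epsilon> > x" "r > 0"
  shows "((\<lambda>\<epsilon>. psi (t \<epsilon> - x) (-1) - psi (h \<epsilon> - x) (-1) - M (t \<epsilon>) + L (h \<epsilon>) + D (t \<epsilon> - h \<epsilon>))
    has_real_derivative 0) (at \<epsilon>)"
proof -
  note [derivative_intros] = t h DERIV_chain2[OF psi_neg1_has_real_derivative]
    DERIV_chain2[OF M t] DERIV_chain2[OF L h]
    DERIV_chain2[where g = "\<lambda>\<epsilon>. t \<epsilon> - h \<epsilon>", OF D DERIV_diff[OF t h]]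
  have "((\<lambda>\<epsilon>. psi (t \<epsilon> - x) (-1) - psi (h \<epsilon> - x) (-1) - M (t \<epsilon>) + L (h \<epsilon>) + D (t \<epsilon> - h \<epsilon>))
    has_real_derivative
      ln (exp (t \<epsilon> - x) - 1) * t' - ln (exp (h \<epsilon> - x) - 1) * h'
      - ln (r * (exp (t \<epsilon> - x) - 1)) * t' + ln (r * (exp (h \<epsilon> - x) - 1)) * h' + ln r * (t' - h')) (at \<epsilon>)"
    using pos by (auto intro!: derivative_eq_intros)
  moreover have "ln (r * (exp (t \<epsilon> - x) - 1)) = ln r + ln (exp (t \<epsilon> - x) - 1)"
    "ln (r * (exp (h \<epsilon> - x) - 1)) = ln r + ln (exp (h \<epsilon> - x) - 1)"
    using pos by (auto intro!: ln_mult_pos)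
  ultimately show ?thesis
    by (elim DERIV_cong) algebra
qed

section \<open>The potential of the diagonal\<close>

lemma ex_antiderivative:
  fixes f :: "real \<Rightarrow> real"
  assumes "open J" "is_interval J" "continuous_on J f"
  obtains F where "\<And>s. s \<in> J \<Longrightarrow> (F has_real_derivative f s) (at s)"
proof (cases "J = {}")
  case False
  then obtain c where "c \<in> J" by blast
  with assms show ?thesis
    by (intro that[of "\<lambda>u. LBINT y=ereal c..ereal u. f y"] LBINT_has_real_derivative) auto
qed (use that in blast)

text \<open>The quotient under the logarithm is the factor \<open>r\<close> of the legs, written in
  the diagonal \<open>\<eta>\<close>. It is positive where numerator and denominator have equal
  signs, which gives two regions; the second one occurs only for \<open>lam < 0\<close>. Coincident
  fields have \<open>\<eta> = 0\<close> and adjoin the first region, hence the continuity claim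
  there.\<close>

lemma diagonal_potential:
  fixes lam mu :: real
  assumes "mu < lam"
  obtains D :: "real \<Rightarrow> real"
  where "continuous_on {\<eta>. \<eta> \<le> 0 \<and> mu < lam * exp \<eta>} D"
    and "\<And>\<eta>. \<eta> < 0 \<Longrightarrow> mu < lam * exp \<eta> \<Longrightarrow>
      (D has_real_derivative ln ((lam * exp \<eta> - mu) / (1 - exp \<eta>))) (at \<eta>)"
    and "\<And>\<eta>. \<eta> > 0 \<Longrightarrow> lam * exp \<eta> < mu \<Longrightarrow>
      (D has_real_derivative ln ((lam * exp \<eta> - mu) / (1 - exp \<eta>))) (at \<eta>)"
proof -
  let ?J1 = "{s. mu < lam * exp s}" and ?J2 = "{s. lam * exp s < mu}"
  \<comment> \<open>The sign of \<open>lam\<close> is arbitrary; \<open>lam * exp y\<close> is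
    monotone in one direction or the other, so both regions are intervals.\<close>
  have lam_exp: "lam * exp y \<le> max (lam * exp a) (lam * exp b) \<and> min (lam * exp a) (lam * exp b) \<le> lam * exp y"
    if "a \<le> y" "y \<le> b" for a b y
    using that by (cases "lam \<ge> 0")
      (auto simp: min_def max_def mult_left_mono mult_left_mono_neg)
  have int: "is_interval ?J1" "is_interval ?J2"
    unfolding is_interval_1 using lam_exp by (fastforce simp: min_def max_def split: if_splits)+
  have op: "open ?J1" "open ?J2"
    by (intro open_Collect_less continuous_intros)+
  obtain K1 where K1: "\<And>s. mu < lam * exp s \<Longrightarrow> (K1 has_real_derivative ln (lam * exp s - mu)) (at s)"
    by (rule ex_antiderivative[OF op(1) int(1), of "\<lambda>s. ln (lam * exp s - mu)"])
      (auto intro!: continuous_intros)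
  obtain K2 where K2: "\<And>s. lam * exp s < mu \<Longrightarrow> (K2 has_real_derivative ln (mu - lam * exp s)) (at s)"
    by (rule ex_antiderivative[OF op(2) int(2), of "\<lambda>s. ln (mu - lam * exp s)"])
      (auto intro!: continuous_intros)
  \<comment> \<open>From \<open>ln (1 - exp \<eta>) = ln (exp (- \<eta>) - 1) + \<eta>\<close> for
    negative \<open>\<eta>\<close>, the denominator integrates to
    \<open>\<eta>\<^sup>2 / 2 - psi (- \<eta>) (-1)\<close>.\<close>
  let ?D1 = "\<lambda>\<eta>. K1 \<eta> - \<eta>\<^sup>2 / 2 + psi (- \<eta>) (-1)" and ?D2 = "\<lambda>\<eta>. K2 \<eta> - psi \<eta> (-1)"
  define D where "D = (\<lambda>\<eta>. if \<eta> \<le> 0 then ?D1 \<eta> else ?D2 \<eta>)"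
  show thesis
  proof
    have "continuous_on ?J1 K1"
      using K1 DERIV_isCont by (force intro!: continuous_at_imp_continuous_on)
    moreover have "continuous_on {..0} (\<lambda>\<eta>::real. psi (- \<eta>) (-1))"
      by (rule continuous_on_compose2[OF continuous_on_psi_neg1]) (auto intro!: continuous_intros)
    ultimately have "continuous_on {\<eta>. \<eta> \<le> 0 \<and> mu < lam * exp \<eta>} ?D1"
      by (intro continuous_on_add continuous_on_diff continuous_intros)
        (auto elim!: continuous_on_subset)
    then show "continuous_on {\<eta>. \<eta> \<le> 0 \<and> mu < lam * exp \<eta>} D"
      by (rule continuous_on_eq) (auto simp: D_def)
  next
    fix \<eta> :: real assume \<eta>: "\<eta> < 0" "mu < lam * exp \<eta>"
    have "(?D1 has_real_derivative ln (lam * exp \<eta> - mu) - \<eta> - ln (exp (- \<eta>) - 1)) (at \<eta>)"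
      using \<eta> by (auto intro!: derivative_eq_intros K1 DERIV_chain2[OF psi_neg1_has_real_derivative])
    moreover have "ln (exp (- \<eta>) - 1) = ln (1 - exp \<eta>) - \<eta>"
    proof -
      have "exp (- \<eta>) - 1 = exp (- \<eta>) * (1 - exp \<eta>)"
        by (simp add: algebra_simps flip: exp_add)
      then show ?thesis
        using \<eta> by (simp add: ln_mult)
    qed
    ultimately have "(?D1 has_real_derivative ln ((lam * exp \<eta> - mu) / (1 - exp \<eta>))) (at \<eta>)"
      using \<eta> by (simp add: ln_div)
    moreover have "\<forall>\<^sub>F s in nhds \<eta>. ?D1 s = D s"
      using eventually_nhds_in_open[of "{..<0}" \<eta>] \<eta> by (auto elim!: eventually_mono simp: D_def)
    ultimately show "(D has_real_derivative ln ((lam * exp \<eta> - mu) / (1 - exp \<eta>))) (at \<eta>)"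
      using DERIV_cong_ev[OF refl _ refl] by metis
  next
    fix \<eta> :: real assume \<eta>: "\<eta> > 0" "lam * exp \<eta> < mu"
    have "(?D2 has_real_derivative ln (mu - lam * exp \<eta>) - ln (exp \<eta> - 1)) (at \<eta>)"
      using \<eta> by (auto intro!: derivative_eq_intros K2 psi_neg1_has_real_derivative)
    moreover have "(lam * exp \<eta> - mu) / (1 - exp \<eta>) = (mu - lam * exp \<eta>) / (exp \<eta> - 1)"
      by (metis minus_diff_eq minus_divide_divide)
    ultimately have "(?D2 has_real_derivative ln ((lam * exp \<eta> - mu) / (1 - exp \<eta>))) (at \<eta>)"
      using \<eta> by (simp add: ln_div)
    moreover have "\<forall>\<^sub>F s in nhds \<eta>. ?D2 s = D s"
      using eventually_nhds_in_open[of "{0<..}" \<eta>] \<eta> by (auto elim!: eventually_mono simp: D_def)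
    ultimately show "(D has_real_derivative ln ((lam * exp \<eta> - mu) / (1 - exp \<eta>))) (at \<eta>)"
      using DERIV_cong_ev[OF refl _ refl] by metis
  qed
qed

section \<open>Conservation along the curve of solutions\<close>

text \<open>Here \<open>exp (t - x) = 1 + \<epsilon> a\<close> and \<open>exp (h - x) = 1 + \<epsilon> b\<close> parametrize the curve of solutions
  of the first superposition formula, with \<open>s = exp (q - x)\<close> and \<open>c = 1\<close>; the choice
  \<open>c = 0\<close>, \<open>s = 1\<close> is the formula at an open end, where formally \<open>q = \<infinity>\<close>.\<close>

lemma leg_sum_const_right:
  fixes x :: real
  assumes "mu < lam" "s > 0" "c \<ge> 0" "a = mu * s + c" "b = lam * s + c" "a > 0"
    and D_cont: "continuous_on {\<eta>. \<eta> \<le> 0 \<and> mu < lam * exp \<eta>} D"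
    and D_deriv: "\<And>\<eta>. \<eta> < 0 \<Longrightarrow> mu < lam * exp \<eta> \<Longrightarrow>
      (D has_real_derivative ln ((lam * exp \<eta> - mu) / (1 - exp \<eta>))) (at \<eta>)"
    and M: "\<And>\<epsilon>. \<epsilon> \<ge> 0 \<Longrightarrow>
      (M has_real_derivative ln (a * (1 + \<epsilon> * c) / s)) (at (x + ln (1 + \<epsilon> * a)))"
    and L: "\<And>\<epsilon>. \<epsilon> \<ge> 0 \<Longrightarrow>
      (L has_real_derivative ln (b * (1 + \<epsilon> * c) / s)) (at (x + ln (1 + \<epsilon> * b)))"
    and "\<epsilon> \<ge> 0" "t = x + ln (1 + \<epsilon> * a)" "h = x + ln (1 + \<epsilon> * b)"
  shows "psi (t - x) (-1) - psi (h - x) (-1) - M t + L h + D (t - h) = L x - M x + D 0"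
proof -
  let ?t = "\<lambda>\<epsilon>. x + ln (1 + \<epsilon> * a)" and ?h = "\<lambda>\<epsilon>. x + ln (1 + \<epsilon> * b)"
  let ?W = "\<lambda>\<epsilon>. psi (?t \<epsilon> - x) (-1) - psi (?h \<epsilon> - x) (-1) - M (?t \<epsilon>) + L (?h \<epsilon>) + D (?t \<epsilon> - ?h \<epsilon>)"
  have ba: "b - a = (lam - mu) * s"
    using assms(4,5) by (simp add: algebra_simps)
  then have "a < b"
    using assms(1,2) by (metis diff_gt_0_iff_gt mult_pos_pos)
  have exp_eta: "exp (?t \<epsilon> - ?h \<epsilon>) = (1 + \<epsilon> * a) / (1 + \<epsilon> * b)" and pos: "1 + \<epsilon> * a > 0" "1 + \<epsilon> * b > 0"
    if "\<epsilon> \<ge> 0" for \<epsilon>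
  proof -
    show p: "1 + \<epsilon> * a > 0" "1 + \<epsilon> * b > 0"
      using that \<open>a < b\<close> \<open>a > 0\<close> by (auto intro!: add_pos_nonneg)
    then show "exp (?t \<epsilon> - ?h \<epsilon>) = (1 + \<epsilon> * a) / (1 + \<epsilon> * b)"
      by (simp add: exp_diff exp_add)
  qed
  have num: "lam * exp (?t \<epsilon> - ?h \<epsilon>) - mu = (lam - mu) * (1 + \<epsilon> * c) / (1 + \<epsilon> * b)" if "\<epsilon> \<ge> 0" for \<epsilon>
    using pos[OF that] unfolding exp_eta[OF that] by (simp add: field_simps) (simp add: assms(4,5) algebra_simps)
  have num_pos: "lam * exp (?t \<epsilon> - ?h \<epsilon>) > mu" if "\<epsilon> \<ge> 0" for \<epsilon>
  proof -
    have "(lam - mu) * (1 + \<epsilon> * c) / (1 + \<epsilon> * b) > 0"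
      using pos(2)[OF that] that assms(1,3)
      by (intro divide_pos_pos mult_pos_pos) (auto intro: add_pos_nonneg)
    then show ?thesis
      using num[OF that] by linarith
  qed
  have eta_le: "?t \<epsilon> - ?h \<epsilon> \<le> 0" if "\<epsilon> \<ge> 0" for \<epsilon>
    using pos[OF that] that \<open>a < b\<close> by (simp add: mult_left_mono)
  \<comment> \<open>The argument of the logarithm in the slope of \<open>M\<close> is
    \<open>a * (1 + \<epsilon> * c) / s\<close>, and \<open>exp (?t \<epsilon> - x) - 1\<close> is
    \<open>\<epsilon> * a\<close>. Their quotient \<open>r\<close> does not contain
    \<open>a\<close>, so it serves for \<open>h\<close> and \<open>b\<close> as well.\<close>
  have deriv: "(?W has_real_derivative 0) (at \<epsilon>)" if "\<epsilon> > 0" for \<epsilon>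
  proof (rule leg_sum_has_derivative_0[where r = "(1 + \<epsilon> * c) / (\<epsilon> * s)"])
    note pos' = pos[OF less_imp_le[OF that]]
    show "(?t has_real_derivative a / (1 + \<epsilon> * a)) (at \<epsilon>)"
      using pos' by (auto intro!: derivative_eq_intros)
    show "(?h has_real_derivative b / (1 + \<epsilon> * b)) (at \<epsilon>)"
      using pos' by (auto intro!: derivative_eq_intros)
    have "(1 + \<epsilon> * c) / (\<epsilon> * s) * (exp (?t \<epsilon> - x) - 1) = a * (1 + \<epsilon> * c) / s"
      "(1 + \<epsilon> * c) / (\<epsilon> * s) * (exp (?h \<epsilon> - x) - 1) = b * (1 + \<epsilon> * c) / s"
      using that pos' by auto
    then show "(M has_real_derivative ln ((1 + \<epsilon> * c) / (\<epsilon> * s) * (exp (?t \<epsilon> - x) - 1))) (at (?t \<epsilon>))"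
      "(L has_real_derivative ln ((1 + \<epsilon> * c) / (\<epsilon> * s) * (exp (?h \<epsilon> - x) - 1))) (at (?h \<epsilon>))"
      using M[of \<epsilon>] L[of \<epsilon>] that by (simp_all only: less_imp_le)
    \<comment> \<open>Here \<open>\<epsilon>\<close> is eliminated: \<open>r\<close> depends on the
      diagonal alone, as the slope of \<open>D\<close> demands.\<close>
    have "\<epsilon> * b - \<epsilon> * a = \<epsilon> * (lam - mu) * s"
      using ba by algebra
    then have "1 - exp (?t \<epsilon> - ?h \<epsilon>) = \<epsilon> * (lam - mu) * s / (1 + \<epsilon> * b)"
      using pos' that by (simp only: exp_eta less_imp_le) (simp add: field_simps)
    then have "(lam * exp (?t \<epsilon> - ?h \<epsilon>) - mu) / (1 - exp (?t \<epsilon> - ?h \<epsilon>)) = (1 + \<epsilon> * c) / (\<epsilon> * s)"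
      using num[of \<epsilon>] pos' that assms(1,2) by (simp only: less_imp_le) (simp add: divide_simps)
    moreover have "?t \<epsilon> - ?h \<epsilon> < 0"
      using pos' that \<open>a < b\<close> by simp
    ultimately show "(D has_real_derivative ln ((1 + \<epsilon> * c) / (\<epsilon> * s))) (at (?t \<epsilon> - ?h \<epsilon>))"
      using D_deriv num_pos[of \<epsilon>] that by (metis less_imp_le)
    show "x < ?t \<epsilon>" "x < ?h \<epsilon>" "(1 + \<epsilon> * c) / (\<epsilon> * s) > 0"
      using that \<open>a > 0\<close> \<open>a < b\<close> assms(2,3)
      by (auto intro!: ln_gt_zero add_pos_nonneg divide_pos_pos)
  qed
  \<comment> \<open>Continuity carries the constancy down to \<open>\<epsilon> = 0\<close>, where
    \<open>t = h = x\<close> and the value is explicit.\<close>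
  have cont: "continuous_on {0..} ?W"
  proof (intro continuous_on_add continuous_on_diff)
    have ln: "continuous_on {0..} (\<lambda>\<epsilon>. ln (1 + \<epsilon> * a))" "continuous_on {0..} (\<lambda>\<epsilon>. ln (1 + \<epsilon> * b))"
      by (intro continuous_intros; use pos in force)+
    then have t: "continuous_on {0..} ?t" and h: "continuous_on {0..} ?h"
      by (auto intro!: continuous_on_add)
    show "continuous_on {0..} (\<lambda>\<epsilon>. psi (?t \<epsilon> - x) (-1))" "continuous_on {0..} (\<lambda>\<epsilon>. psi (?h \<epsilon> - x) (-1))"
      using \<open>a > 0\<close> \<open>a < b\<close>
      by (auto intro!: continuous_on_compose2[OF continuous_on_psi_neg1] ln)
    show "continuous_on {0..} (\<lambda>\<epsilon>. M (?t \<epsilon>))"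
      by (rule continuous_on_compose2[OF _ t subset_refl])
        (use M DERIV_isCont in \<open>blast intro!: continuous_at_imp_continuous_on\<close>)
    show "continuous_on {0..} (\<lambda>\<epsilon>. L (?h \<epsilon>))"
      by (rule continuous_on_compose2[OF _ h subset_refl])
        (use L DERIV_isCont in \<open>blast intro!: continuous_at_imp_continuous_on\<close>)
    show "continuous_on {0..} (\<lambda>\<epsilon>. D (?t \<epsilon> - ?h \<epsilon>))"
      by (rule continuous_on_compose2[OF D_cont continuous_on_diff[OF t h]])
        (use eta_le num_pos in auto)
  qed
  have "?W \<epsilon> = ?W 0"
  proof (cases "\<epsilon> = 0")
    case False
    then have "\<epsilon> > 0"
      using \<open>\<epsilon> \<ge> 0\<close> by simp
    show ?thesis
      by (rule DERIV_isconst_end[OF \<open>\<epsilon> > 0\<close>])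
        (use deriv continuous_on_subset[OF cont] in auto)
  qed simp
  then show ?thesis
    using assms by simp
qed

text \<open>The branch of the curve with both coefficients negative. Positive arguments of the
  logarithms force \<open>\<epsilon> < -1\<close>, so the branch does not reach
  \<open>\<epsilon> = 0\<close> and two of its points are compared directly. The diagonal is
  positive here, which is the second region of \<open>D\<close>.\<close>

lemma leg_sum_const_left:
  fixes x :: real
  assumes "mu < lam" "s > 0" "a = mu * s + 1" "b = lam * s + 1" "b < 0"
    and D_deriv: "\<And>\<eta>. \<eta> > 0 \<Longrightarrow> lam * exp \<eta> < mu \<Longrightarrow>
      (D has_real_derivative ln ((lam * exp \<eta> - mu) / (1 - exp \<eta>))) (at \<eta>)"
    and M: "\<And>\<epsilon>. \<epsilon> < -1 \<Longrightarrow>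
      (M has_real_derivative ln (a * (1 + \<epsilon>) / s)) (at (x + ln (1 + \<epsilon> * a)))"
    and L: "\<And>\<epsilon>. \<epsilon> < -1 \<Longrightarrow>
      (L has_real_derivative ln (b * (1 + \<epsilon>) / s)) (at (x + ln (1 + \<epsilon> * b)))"
    and "\<epsilon> < -1" "t = x + ln (1 + \<epsilon> * a)" "h = x + ln (1 + \<epsilon> * b)"
    and "\<epsilon>' < -1" "t' = x + ln (1 + \<epsilon>' * a)" "h' = x + ln (1 + \<epsilon>' * b)"
  shows "psi (t - x) (-1) - psi (h - x) (-1) - M t + L h + D (t - h)
    = psi (t' - x) (-1) - psi (h' - x) (-1) - M t' + L h' + D (t' - h')"
proof -
  let ?t = "\<lambda>\<epsilon>. x + ln (1 + \<epsilon> * a)" and ?h = "\<lambda>\<epsilon>. x + ln (1 + \<epsilon> * b)"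
  let ?W = "\<lambda>\<epsilon>. psi (?t \<epsilon> - x) (-1) - psi (?h \<epsilon> - x) (-1) - M (?t \<epsilon>) + L (?h \<epsilon>) + D (?t \<epsilon> - ?h \<epsilon>)"
  have ba: "b - a = (lam - mu) * s"
    using assms(3,4) by (simp add: algebra_simps)
  then have "a < b"
    using assms(1,2) by (metis diff_gt_0_iff_gt mult_pos_pos)
  have deriv: "(?W has_real_derivative 0) (at \<epsilon>)" if "\<epsilon> < -1" for \<epsilon>
  proof (rule leg_sum_has_derivative_0[where r = "(1 + \<epsilon>) / (\<epsilon> * s)"])
    have eb: "\<epsilon> * b > 0" "\<epsilon> * a > \<epsilon> * b"
      using that \<open>a < b\<close> \<open>b < 0\<close> by (auto intro!: mult_neg_neg mult_strict_left_mono_neg)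
    then have pos: "1 + \<epsilon> * a > 0" "1 + \<epsilon> * b > 0" by auto
    show "(?t has_real_derivative a / (1 + \<epsilon> * a)) (at \<epsilon>)"
      using pos by (auto intro!: derivative_eq_intros)
    show "(?h has_real_derivative b / (1 + \<epsilon> * b)) (at \<epsilon>)"
      using pos by (auto intro!: derivative_eq_intros)
    have "(1 + \<epsilon>) / (\<epsilon> * s) * (exp (?t \<epsilon> - x) - 1) = a * (1 + \<epsilon>) / s"
      "(1 + \<epsilon>) / (\<epsilon> * s) * (exp (?h \<epsilon> - x) - 1) = b * (1 + \<epsilon>) / s"
      using that pos by auto
    then show "(M has_real_derivative ln ((1 + \<epsilon>) / (\<epsilon> * s) * (exp (?t \<epsilon> - x) - 1))) (at (?t \<epsilon>))"
      "(L has_real_derivative ln ((1 + \<epsilon>) / (\<epsilon> * s) * (exp (?h \<epsilon> - x) - 1))) (at (?h \<epsilon>))"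
      using M[OF that] L[OF that] by (simp_all only:)
    have exp_eta: "exp (?t \<epsilon> - ?h \<epsilon>) = (1 + \<epsilon> * a) / (1 + \<epsilon> * b)"
      using pos by (simp add: exp_diff exp_add)
    have num: "lam * exp (?t \<epsilon> - ?h \<epsilon>) - mu = (lam - mu) * (1 + \<epsilon>) / (1 + \<epsilon> * b)"
      using pos unfolding exp_eta by (simp add: field_simps) (simp add: assms(3,4) algebra_simps)
    have "(lam - mu) * (1 + \<epsilon>) / (1 + \<epsilon> * b) < 0"
      using pos that assms(1) by (intro divide_neg_pos mult_pos_neg) auto
    then have num_neg: "lam * exp (?t \<epsilon> - ?h \<epsilon>) < mu"
      using num by linarith
    have "\<epsilon> * b - \<epsilon> * a = \<epsilon> * (lam - mu) * s"
      using ba by algebra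
    then have "1 - exp (?t \<epsilon> - ?h \<epsilon>) = \<epsilon> * (lam - mu) * s / (1 + \<epsilon> * b)"
      using pos that unfolding exp_eta by (simp add: field_simps)
    then have "(lam * exp (?t \<epsilon> - ?h \<epsilon>) - mu) / (1 - exp (?t \<epsilon> - ?h \<epsilon>)) = (1 + \<epsilon>) / (\<epsilon> * s)"
      using num pos that assms(1,2) by (simp only:) (simp add: divide_simps)
    moreover have "?t \<epsilon> - ?h \<epsilon> > 0"
      using pos eb by simp
    ultimately show "(D has_real_derivative ln ((1 + \<epsilon>) / (\<epsilon> * s))) (at (?t \<epsilon> - ?h \<epsilon>))"
      using D_deriv num_neg by metis
    show "x < ?t \<epsilon>" "x < ?h \<epsilon>" "(1 + \<epsilon>) / (\<epsilon> * s) > 0"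
      using that less_trans[OF eb] eb(1) \<open>s > 0\<close>
      by (auto intro!: ln_gt_zero divide_neg_neg mult_neg_pos)
  qed
  have "?W \<epsilon> = ?W \<epsilon>'"
  proof (rule DERIV_isconst3[where f = ?W and b = "-1"])
    show "min \<epsilon> \<epsilon>' - 1 < -1"
      using assms by auto
  qed (use deriv assms in auto)
  then show ?thesis
    using assms by simp
qed

section \<open>Closure for one pair of neighbouring sites\<close>

text \<open>The arguments \<open>x, t, h\<close> stand for the fields \<open>x, xt, xh\<close> at site \<open>k + 1\<close>, and
  \<open>q, t', h'\<close> for \<open>xht, xt, xh\<close> at site \<open>k\<close>. In the boundary versions these sites are \<open>1\<close>
  and \<open>N\<close>.\<close>

definition quad_sum :: "real \<Rightarrow> real \<Rightarrow> real \<Rightarrow> real \<Rightarrow> real \<Rightarrow> real \<Rightarrow> real \<Rightarrow> real \<Rightarrow> real" where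
  "quad_sum lam mu x t h q t' h' =
    psi (t - x) (-1) - psi (h - x) (-1) - psi (t - q) mu + psi (h - q) lam
    - psi (x - t') lam + psi (x - h') mu + psi (q - t') (-1) - psi (q - h') (-1)"

definition quad_ok :: "real \<Rightarrow> real \<Rightarrow> real \<Rightarrow> real \<Rightarrow> real \<Rightarrow> real \<Rightarrow> real \<Rightarrow> real \<Rightarrow> bool" where
  "quad_ok lam mu x t h q t' h' \<longleftrightarrow>
    x \<le> t \<and> x \<le> h \<and> t' \<le> q \<and> h' \<le> q \<and>
    0 < lam + exp (x - t') \<and> 0 < mu + exp (x - h') \<and>
    0 < lam + exp (h - q) \<and> 0 < mu + exp (t - q) \<and>
    (exp (t - x) - 1) * (lam + exp (x - t')) = (exp (h - x) - 1) * (mu + exp (x - h')) \<and>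
    (exp (q - h') - 1) * (lam + exp (h - q)) = (exp (q - t') - 1) * (mu + exp (t - q))"

text \<open>These are the terms of the closure relation that the inner pairs leave over:
  \<open>psi\<close> legs at the sites 1 and N, and the linear terms with \<open>ln lam\<close> and
  \<open>ln mu\<close>.\<close>

definition boundary_quad_sum :: "real \<Rightarrow> real \<Rightarrow> real \<Rightarrow> real \<Rightarrow> real \<Rightarrow> real \<Rightarrow> real \<Rightarrow> real \<Rightarrow> real" where
  "boundary_quad_sum lam mu x t h q t' h' =
    psi (t - x) (-1) - psi (h - x) (-1) + psi (q - t') (-1) - psi (q - h') (-1)
    + (t' - x) * ln lam + (q - t) * ln mu - (h' - x) * ln mu - (q - h) * ln lam"

definition boundary_quad_ok :: "real \<Rightarrow> real \<Rightarrow> real \<Rightarrow> real \<Rightarrow> real \<Rightarrow> real \<Rightarrow> real \<Rightarrow> real \<Rightarrow> bool" where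
  "boundary_quad_ok lam mu x t h q t' h' \<longleftrightarrow> x \<le> t \<and> h' \<le> q \<and>
    (exp (t - x) - 1) * lam = (exp (h - x) - 1) * mu \<and>
    (exp (q - h') - 1) * lam = (exp (q - t') - 1) * mu"

text \<open>Multiplied by \<open>s\<close>, the arguments of the logarithms become sums such as
  \<open>\<alpha> + a\<close>, and the equations take the form of
  \<open>quad_algebra\<close>.\<close>

lemma quad_ok_imp:
  fixes lam mu x t h q t' h' :: real
  assumes "quad_ok lam mu x t h q t' h'"
    and defs: "s = exp (q - x)" "\<alpha> = mu * s + 1" "\<beta> = lam * s + 1"
      "a = exp (t - x) - 1" "b = exp (h - x) - 1" "c = exp (q - t') - 1" "d = exp (q - h') - 1"
  shows "a \<ge> 0" "b \<ge> 0" "c \<ge> 0" "d \<ge> 0"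
    and "\<alpha> + a > 0" "\<alpha> + d > 0" "\<beta> + b > 0" "\<beta> + c > 0"
    and "\<beta> * a = \<alpha> * b" "\<beta> * d = \<alpha> * c"
proof -
  note ok = assms(1)[unfolded quad_ok_def]
  have "s > 0" using defs by simp
  have scale: "\<alpha> + a = s * (mu + exp (t - q))" "\<alpha> + d = s * (mu + exp (x - h'))"
    "\<beta> + b = s * (lam + exp (h - q))" "\<beta> + c = s * (lam + exp (x - t'))"
    unfolding defs by (simp_all add: ring_distribs flip: exp_add)
  show nonneg: "a \<ge> 0" "b \<ge> 0" "c \<ge> 0" "d \<ge> 0"
    using ok by (auto simp: defs)
  show pos: "\<alpha> + a > 0" "\<alpha> + d > 0" "\<beta> + b > 0" "\<beta> + c > 0"
    using ok \<open>s > 0\<close> unfolding scale by simp_all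
  have "a * (lam + exp (x - t')) = b * (mu + exp (x - h'))"
    "d * (lam + exp (h - q)) = c * (mu + exp (t - q))"
    using ok by (simp_all add: defs)
  then have "a * (\<beta> + c) = b * (\<alpha> + d)" "d * (\<beta> + b) = c * (\<alpha> + a)"
    unfolding scale by algebra+
  then show "\<beta> * a = \<alpha> * b" "\<beta> * d = \<alpha> * c"
    using quad_algebra[of \<alpha> a d \<beta> c b] pos nonneg by auto
qed

lemma exp_eq_imp_eq_ln:
  fixes x t :: real
  assumes "exp (t - x) - 1 = y"
  shows "t = x + ln (1 + y)"
proof -
  have "1 + y = exp (t - x)" using assms by simp
  then show ?thesis by (simp only: ln_exp)
qed

text \<open>The pair \<open>(t, h)\<close> and the reflection of \<open>(t', h')\<close> lie on one
  curve, with parameters \<open>a / \<alpha>\<close> and \<open>d / \<alpha>\<close>. The sign of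
  \<open>\<alpha>\<close> selects the branch, and \<open>\<alpha> = 0\<close> contradicts
  \<open>\<alpha> + a > 0\<close>.\<close>

lemma quad_closed:
  fixes lam mu x t h q t' h' :: real
  assumes "mu < lam" "mu > -1" and ok: "quad_ok lam mu x t h q t' h'"
    and D: "continuous_on {\<eta>. \<eta> \<le> 0 \<and> mu < lam * exp \<eta>} D"
      "\<And>\<eta>. \<eta> < 0 \<Longrightarrow> mu < lam * exp \<eta> \<Longrightarrow>
        (D has_real_derivative ln ((lam * exp \<eta> - mu) / (1 - exp \<eta>))) (at \<eta>)"
      "\<And>\<eta>. \<eta> > 0 \<Longrightarrow> lam * exp \<eta> < mu \<Longrightarrow>
        (D has_real_derivative ln ((lam * exp \<eta> - mu) / (1 - exp \<eta>))) (at \<eta>)"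
  shows "quad_sum lam mu x t h q t' h' = D (t' - h') - D (t - h)"
proof -
  define s \<alpha> \<beta> a b c d where defs: "s = exp (q - x)" "\<alpha> = mu * s + 1" "\<beta> = lam * s + 1"
      "a = exp (t - x) - 1" "b = exp (h - x) - 1" "c = exp (q - t') - 1" "d = exp (q - h') - 1"
  note q = quad_ok_imp[OF ok defs]
  have "s > 0" using defs by simp
  have "\<beta> - \<alpha> = (lam - mu) * s"
    by (simp add: defs algebra_simps)
  then have "\<alpha> < \<beta>"
    using \<open>s > 0\<close> \<open>mu < lam\<close> by (metis diff_gt_0_iff_gt mult_pos_pos)
  \<comment> \<open>\<open>quad_sum\<close> is the difference of two values of one function: the reflection
    \<open>(t', h') \<mapsto> (x + q - h', x + q - t')\<close> preserves the difference of the two entries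
    and maps the quad equations onto each other.\<close>
  let ?M = "\<lambda>t. psi (t - q) mu" and ?L = "\<lambda>h. psi (h - q) lam"
  let ?t = "x + q - h'" and ?h = "x + q - t'"
  let ?W = "\<lambda>t h. psi (t - x) (-1) - psi (h - x) (-1) - ?M t + ?L h + D (t - h)"
  have t: "t = x + ln (1 + \<epsilon> * \<alpha>)" "h = x + ln (1 + \<epsilon> * \<beta>)" if "\<epsilon> = a / \<alpha>" "\<alpha> \<noteq> 0" for \<epsilon>
  proof -
    have "a = \<epsilon> * \<alpha>" "b = \<epsilon> * \<beta>"
      using that q(9) by (auto simp: field_simps)
    then show "t = x + ln (1 + \<epsilon> * \<alpha>)" "h = x + ln (1 + \<epsilon> * \<beta>)"
      by (auto intro!: exp_eq_imp_eq_ln simp: defs(4,5))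
  qed
  have t': "?t = x + ln (1 + \<epsilon> * \<alpha>)" "?h = x + ln (1 + \<epsilon> * \<beta>)" if "\<epsilon> = d / \<alpha>" "\<alpha> \<noteq> 0" for \<epsilon>
  proof -
    have "d = \<epsilon> * \<alpha>" "c = \<epsilon> * \<beta>"
      using that q(10) by (auto simp: field_simps)
    then have e: "exp (?t - x) - 1 = \<epsilon> * \<alpha>" "exp (?h - x) - 1 = \<epsilon> * \<beta>"
      by (simp_all add: defs(6,7))
    show "?t = x + ln (1 + \<epsilon> * \<alpha>)" "?h = x + ln (1 + \<epsilon> * \<beta>)"
      using e[THEN exp_eq_imp_eq_ln] by simp_all
  qed
  \<comment> \<open>On the curve \<open>exp (u - q) + \<nu>\<close> factorizes as
    \<open>e * (1 + \<epsilon>) / s\<close>, because \<open>e = \<nu> * s + 1\<close>.\<close>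
  have leg: "((\<lambda>u. psi (u - q) \<nu>) has_real_derivative ln (e * (1 + \<epsilon>) / s)) (at (x + ln (1 + \<epsilon> * e)))"
    if "\<nu> > -1" "e = \<nu> * s + 1" "1 + \<epsilon> * e > 0" "e * (1 + \<epsilon>) > 0" for \<nu> e \<epsilon>
  proof -
    let ?u = "x + ln (1 + \<epsilon> * e)"
    have "exp (?u - q) = (1 + \<epsilon> * e) / s"
      using that by (simp add: defs(1) exp_add exp_diff)
    then have eq: "exp (?u - q) + \<nu> = e * (1 + \<epsilon>) / s"
      using \<open>s > 0\<close> that(2) by (simp add: field_simps)
    also have "\<dots> > 0"
      using that(4) \<open>s > 0\<close> by simp
    finally have "((\<lambda>u. psi (u - q) \<nu>) has_real_derivative ln (exp (?u - q) + \<nu>) * 1) (at ?u)"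
      by (intro DERIV_chain2[where g = "\<lambda>u. u - q"] psi_has_real_derivative that(1))
        (auto intro!: derivative_eq_intros)
    then show ?thesis
      by (simp only: eq mult_1_right)
  qed
  have "?W t h = ?W ?t ?h"
  proof (cases \<alpha> "0::real" rule: linorder_cases)
    case greater
    have M: "(?M has_real_derivative ln (\<alpha> * (1 + \<epsilon> * 1) / s)) (at (x + ln (1 + \<epsilon> * \<alpha>)))"
      and L: "(?L has_real_derivative ln (\<beta> * (1 + \<epsilon> * 1) / s)) (at (x + ln (1 + \<epsilon> * \<beta>)))"
      if "\<epsilon> \<ge> 0" for \<epsilon>
      using leg[of mu \<alpha> \<epsilon>] leg[of lam \<beta> \<epsilon>] assms(1,2) that greater \<open>\<alpha> < \<beta>\<close>
      by (simp_all add: defs(2,3)[symmetric] add_pos_nonneg)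
    have W: "?W u v = ?L x - ?M x + D 0"
      if "\<epsilon> \<ge> 0" "u = x + ln (1 + \<epsilon> * \<alpha>)" "v = x + ln (1 + \<epsilon> * \<beta>)" for u v \<epsilon>
      by (rule leg_sum_const_right[OF \<open>mu < lam\<close> \<open>s > 0\<close> zero_le_one defs(2,3) greater D(1) _ _ _ that])
        (erule (1) D(2) | erule M | erule L)+
    have "a / \<alpha> \<ge> 0" "d / \<alpha> \<ge> 0" "\<alpha> \<noteq> 0"
      using greater q(1,4) by simp_all
    then show ?thesis
      using W[OF _ t[OF refl]] W[OF _ t'[OF refl]] by simp
  next
    \<comment> \<open>Since \<open>\<alpha> + a\<close> and \<open>\<alpha> + d\<close> are
      positive, both parameters lie below -1, and \<open>\<beta> * a = \<alpha> * b\<close> forces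
      \<open>\<beta>\<close> to be negative too.\<close>
    case less
    have "a > 0" "d > 0" using less q(5,6) by auto
    have "\<beta> \<noteq> 0"
    proof
      assume "\<beta> = 0"
      then have "b = 0" using q(9) less by simp
      then show False using q(7) \<open>\<beta> = 0\<close> by simp
    qed
    moreover have "\<beta> * a \<le> 0"
      unfolding q(9) using less q(2) by (simp add: mult_nonpos_nonneg)
    ultimately have "\<beta> < 0"
      using \<open>a > 0\<close> by (simp add: mult_le_0_iff)
    have M: "(?M has_real_derivative ln (\<alpha> * (1 + \<epsilon>) / s)) (at (x + ln (1 + \<epsilon> * \<alpha>)))"
      and L: "(?L has_real_derivative ln (\<beta> * (1 + \<epsilon>) / s)) (at (x + ln (1 + \<epsilon> * \<beta>)))"
      if "\<epsilon> < -1" for \<epsilon>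
    proof -
      have "\<epsilon> * \<alpha> > 0" "\<epsilon> * \<beta> > 0" "\<alpha> * (1 + \<epsilon>) > 0" "\<beta> * (1 + \<epsilon>) > 0"
        using less \<open>\<beta> < 0\<close> that by (auto intro!: mult_neg_neg)
      then show "(?M has_real_derivative ln (\<alpha> * (1 + \<epsilon>) / s)) (at (x + ln (1 + \<epsilon> * \<alpha>)))"
        "(?L has_real_derivative ln (\<beta> * (1 + \<epsilon>) / s)) (at (x + ln (1 + \<epsilon> * \<beta>)))"
        using leg[of mu \<alpha> \<epsilon>] leg[of lam \<beta> \<epsilon>] assms(1,2) defs(2,3) by auto
    qed
    have "a / \<alpha> < -1" "d / \<alpha> < -1" "\<alpha> \<noteq> 0"
      using q(5,6) less by (auto simp: divide_simps)
    then show ?thesis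
      by (intro leg_sum_const_left[OF \<open>mu < lam\<close> \<open>s > 0\<close> defs(2,3) \<open>\<beta> < 0\<close> _ _ _
            _ t[OF refl] _ t'[OF refl]])
        (assumption | erule (1) D(3) | erule M | erule L)+
  next
    case equal
    then have "a = 0" using q(9) \<open>\<alpha> < \<beta>\<close> by simp
    then show ?thesis using q(5) equal by simp
  qed
  then show ?thesis
    by (simp add: quad_sum_def)
qed

text \<open>If \<open>\<alpha> \<noteq> 0\<close>, the formulas force \<open>t = h\<close> and
  \<open>t' = h'\<close>, so both sides vanish whatever the value of \<open>ln (- lam)\<close> is.
  If \<open>\<alpha> = 0\<close>, then \<open>- lam = exp (x - q)\<close> and the \<open>psi\<close>
  legs with parameter \<open>lam\<close> are shifts of those with parameter -1, up to a linear
  term.\<close>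

lemma quad_closed_same_parameter:
  fixes lam x t h q t' h' :: real
  assumes "lam > -1" and ok: "quad_ok lam lam x t h q t' h'"
  shows "quad_sum lam lam x t h q t' h' = ln (- lam) * (t' - h') - ln (- lam) * (t - h)"
proof -
  define s \<alpha> a b c d where defs: "s = exp (q - x)" "\<alpha> = lam * s + 1"
      "a = exp (t - x) - 1" "b = exp (h - x) - 1" "c = exp (q - t') - 1" "d = exp (q - h') - 1"
  note q = quad_ok_imp[OF ok defs(1,2,2-6)]
  show ?thesis
  proof (cases "\<alpha> = 0")
    case False
    then have "a = b" "c = d" using q(9,10) by auto
    then have "t = h" "t' = h'" by (auto simp: defs)
    then show ?thesis by (simp add: quad_sum_def)
  next
    case True
    have "- lam = exp (x - q)"
      using True by (simp add: defs exp_diff field_simps)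
    then have q_eq: "q = x - ln (- lam)" and "lam < 0"
      by (auto simp flip: neg_0_less_iff_less)
    have "a > 0" "b > 0" "c > 0" "d > 0"
      using q(5-8) True by auto
    then have pos: "t > x" "h > x" "t' < q" "h' < q"
      by (auto simp: defs(3-6))
    have const: "psi \<xi> (-1) - psi (\<xi> + ln (- lam)) lam + ln (- lam) * \<xi>
      = psi \<zeta> (-1) - psi (\<zeta> + ln (- lam)) lam + ln (- lam) * \<zeta>" (is "?f \<xi> = ?f \<zeta>")
      if "\<xi> > 0" "\<zeta> > 0" for \<xi> \<zeta>
    proof (rule DERIV_isconst3[where f = ?f and a = 0 and b = "max \<xi> \<zeta> + 1"])
      fix y :: real assume "y \<in> {0<..<max \<xi> \<zeta> + 1}"
      then have "y > 0" by auto
      have e: "exp (y + ln (- lam)) + lam = - lam * (exp y - 1)"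
        using \<open>lam < 0\<close> by (simp add: exp_add algebra_simps)
      also have "\<dots> > 0"
        using \<open>lam < 0\<close> \<open>y > 0\<close> by (simp add: mult_neg_pos)
      finally have "0 < exp (y + ln (- lam)) + lam" .
      then have "(?f has_real_derivative ln (exp y - 1) - ln (- lam * (exp y - 1)) + ln (- lam)) (at y)"
        using \<open>y > 0\<close> \<open>lam > -1\<close> e
        by (auto intro!: derivative_eq_intros psi_neg1_has_real_derivative
            DERIV_chain2[OF psi_has_real_derivative])
      moreover have "ln (- lam * (exp y - 1)) = ln (- lam) + ln (exp y - 1)"
        using \<open>lam < 0\<close> \<open>y > 0\<close> by (intro ln_mult_pos) auto
      ultimately show "(?f has_real_derivative 0) (at y)"
        by simp
    qed (use that in auto)
    have shift: "t - x + ln (- lam) = t - q" "h - x + ln (- lam) = h - q"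
      "q - t' + ln (- lam) = x - t'" "q - h' + ln (- lam) = x - h'"
      using q_eq by auto
    have "?f (t - x) = ?f (h - x)" "?f (q - t') = ?f (q - h')"
      using pos by (auto intro!: const)
    then show ?thesis
      unfolding shift quad_sum_def by (simp add: algebra_simps)
  qed
qed

text \<open>The degenerate curve with \<open>c = 0\<close> and \<open>s = 1\<close>, on which the
  legs \<open>M\<close> and \<open>L\<close> are linear. Both vanish at \<open>x\<close>, so the
  actual pair and the reflected pair give the same value \<open>D 0\<close>.\<close>

lemma boundary_quad_closed:
  fixes lam mu x t h q t' h' :: real
  assumes "mu < lam" "mu > 0" and ok: "boundary_quad_ok lam mu x t h q t' h'"
    and D: "continuous_on {\<eta>. \<eta> \<le> 0 \<and> mu < lam * exp \<eta>} D"
      "\<And>\<eta>. \<eta> < 0 \<Longrightarrow> mu < lam * exp \<eta> \<Longrightarrow>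
        (D has_real_derivative ln ((lam * exp \<eta> - mu) / (1 - exp \<eta>))) (at \<eta>)"
  shows "boundary_quad_sum lam mu x t h q t' h' = D (t' - h') - D (t - h)"
proof -
  let ?M = "\<lambda>t. (t - x) * ln mu" and ?L = "\<lambda>h. (h - x) * ln lam"
  let ?W = "\<lambda>t h. psi (t - x) (-1) - psi (h - x) (-1) - ?M t + ?L h + D (t - h)"
  have "?W u v = D 0" if "u \<ge> x" "(exp (u - x) - 1) * lam = (exp (v - x) - 1) * mu" for u v
  proof -
    define \<epsilon> where "\<epsilon> = (exp (u - x) - 1) / mu"
    have \<epsilon>: "\<epsilon> \<ge> 0" "u = x + ln (1 + \<epsilon> * mu)" "v = x + ln (1 + \<epsilon> * lam)"
    proof -
      show "\<epsilon> \<ge> 0"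
        using that \<open>mu > 0\<close> by (simp add: \<epsilon>_def)
      have "exp (u - x) - 1 = \<epsilon> * mu" "exp (v - x) - 1 = \<epsilon> * lam"
        using that \<open>mu > 0\<close> by (simp_all add: \<epsilon>_def)
      then show "u = x + ln (1 + \<epsilon> * mu)" "v = x + ln (1 + \<epsilon> * lam)"
        by (auto intro!: exp_eq_imp_eq_ln)
    qed
    have leg: "((\<lambda>t. (t - x) * ln \<nu>) has_real_derivative ln (\<nu> * (1 + \<delta> * 0) / 1)) (at y)" for \<nu> \<delta> y
      by (auto intro!: derivative_eq_intros)
    have "?W u v = ?L x - ?M x + D 0"
      by (rule leg_sum_const_right[OF \<open>mu < lam\<close> zero_less_one order_refl _ _ \<open>mu > 0\<close> D(1) _ leg leg \<epsilon>])
        (simp | erule (1) D(2))+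
    then show ?thesis by simp
  qed
  from this[of t h] this[of "x + q - h'" "x + q - t'"] show ?thesis
    using ok by (simp add: boundary_quad_ok_def boundary_quad_sum_def algebra_simps)
qed

text \<open>The potential \<open>D\<close> is fixed before the fields: it depends on
  \<open>lam\<close> and \<open>mu\<close> only, so that one \<open>D\<close> serves all sites and
  the sum telescopes.\<close>

lemma ex_quad_potential:
  fixes lam mu :: real
  assumes "mu \<le> lam" "mu > -1"
  obtains D :: "real \<Rightarrow> real"
  where "\<And>x t h q t' h'. quad_ok lam mu x t h q t' h' \<Longrightarrow>
      quad_sum lam mu x t h q t' h' = D (t' - h') - D (t - h)"
    and "\<And>x t h q t' h'. mu > 0 \<Longrightarrow> boundary_quad_ok lam mu x t h q t' h' \<Longrightarrow>
      boundary_quad_sum lam mu x t h q t' h' = D (t' - h') - D (t - h)"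
proof (cases "mu = lam")
  case True
  show ?thesis
  proof
    show "quad_sum lam mu x t h q t' h' = ln (- lam) * (t' - h') - ln (- lam) * (t - h)"
      if "quad_ok lam mu x t h q t' h'" for x t h q t' h'
      using that assms True by (auto intro: quad_closed_same_parameter)
    show "boundary_quad_sum lam mu x t h q t' h' = ln (- lam) * (t' - h') - ln (- lam) * (t - h)"
      if "mu > 0" "boundary_quad_ok lam mu x t h q t' h'" for x t h q t' h'
      using that True by (auto simp: boundary_quad_ok_def boundary_quad_sum_def)
  qed
next
  case False
  then have "mu < lam" using assms by simp
  obtain D where D: "continuous_on {\<eta>. \<eta> \<le> 0 \<and> mu < lam * exp \<eta>} D"
      "\<And>\<eta>. \<eta> < 0 \<Longrightarrow> mu < lam * exp \<eta> \<Longrightarrow>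
        (D has_real_derivative ln ((lam * exp \<eta> - mu) / (1 - exp \<eta>))) (at \<eta>)"
      "\<And>\<eta>. \<eta> > 0 \<Longrightarrow> lam * exp \<eta> < mu \<Longrightarrow>
        (D has_real_derivative ln ((lam * exp \<eta> - mu) / (1 - exp \<eta>))) (at \<eta>)"
    using diagonal_potential[OF \<open>mu < lam\<close>] by blast
  show ?thesis
    by (rule that[of D])
      (rule quad_closed[OF \<open>mu < lam\<close> \<open>mu > -1\<close> _ D] boundary_quad_closed[OF \<open>mu < lam\<close> _ _ D(1,2)];
        assumption)+
qed

subsection \<open>Summation over the lattice\<close>

lemma psi_ok_nonneg:
  assumes "psi_ok \<xi> \<nu>" "\<nu> \<le> -1"
  shows "\<xi> \<ge> 0"
proof (rule ccontr)
  assume "\<not> \<xi> \<ge> 0"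
  then have "exp \<xi> + \<nu> > 0" "exp \<xi> < 1"
    using assms(1) by (auto simp: psi_ok_def)
  then show False using assms(2) by simp
qed

text \<open>The endpoint 0, which \<open>psi_ok\<close> exempts, is covered by
  \<open>\<nu> > -1\<close>.\<close>

lemma psi_ok_pos:
  assumes "psi_ok \<xi> \<nu>" "\<nu> > -1"
  shows "\<nu> + exp \<xi> > 0"
proof (cases "\<xi> = 0")
  case False
  then have "exp \<xi> + \<nu> > 0"
    using assms(1) by (auto simp: psi_ok_def)
  then show ?thesis by simp
qed (use assms in simp)

lemma Lam_ok_le:
  assumes "Lam_ok b N y z \<nu>" "k \<in> {1..int N}"
  shows "y k \<le> z k"
proof -
  have "psi_ok (z k - y k) (-1)"
    using assms by (cases b) (simp_all add: Lam_ok_def)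
  then show ?thesis
    using psi_ok_nonneg by fastforce
qed

lemma Lam_ok_Periodic_psi_ok:
  assumes "Lam_ok Periodic N y z \<nu>" "k \<in> {1..int N}"
  shows "psi_ok (y (pidx N (k + 1)) - z k) \<nu>"
  using assms by (simp add: Lam_ok_def)

section \<open>Cyclic indices and sums over sites\<close>

lemma pidx_simps:
  assumes "1 \<le> k" "k \<le> int N"
  shows "pidx N k = k" "pidx N (pidx N (k + 1)) = pidx N (k + 1)"
    "pidx N (pidx N (k + 1) - 1) = k" "1 \<le> pidx N (k + 1)" "pidx N (k + 1) \<le> int N"
proof -
  have N: "int N > 0" using assms by simp
  show *: "pidx N k = k"
    using assms by (simp add: pidx_def)
  show "pidx N (pidx N (k + 1)) = pidx N (k + 1)"
    by (simp add: pidx_def)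
  have "pidx N (pidx N (k + 1) - 1) = pidx N k"
    by (simp add: pidx_def mod_diff_left_eq)
  then show "pidx N (pidx N (k + 1) - 1) = k" using * by simp
  show "1 \<le> pidx N (k + 1)" "pidx N (k + 1) \<le> int N"
    using N by (simp_all add: pidx_def add1_zle_eq)
qed

lemma sum_pidx_shift:
  fixes f :: "int \<Rightarrow> real"
  shows "(\<Sum>k=1..int N. f (pidx N (k + 1))) = (\<Sum>k=1..int N. f k)"
proof (rule sum.reindex_bij_witness[of _ "\<lambda>k. pidx N (k - 1)" "\<lambda>k. pidx N (k + 1)"])
  fix k assume k: "k \<in> {1..int N}"
  then have N: "int N > 0" by simp
  show "pidx N (pidx N (k + 1) - 1) = k" "pidx N (k + 1) \<in> {1..int N}"
    using k pidx_simps[of k N] by auto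
  have "pidx N (pidx N (k - 1) + 1) = pidx N k"
    using mod_add_left_eq[of "k - 2" "int N" 1] by (simp add: pidx_def add.commute)
  then show "pidx N (pidx N (k - 1) + 1) = k"
    using k pidx_simps[of k N] by simp
  show "pidx N (k - 1) \<in> {1..int N}"
    using N by (simp add: pidx_def add1_zle_eq)
qed simp

text \<open>The increments around the cycle are nonnegative and add up to 0.\<close>

lemma pidx_increasing_imp_constant:
  fixes f :: "int \<Rightarrow> real"
  assumes "\<And>k. k \<in> {1..int N} \<Longrightarrow> f k \<le> f (pidx N (k + 1))" and "k \<in> {1..int N}"
  shows "f (pidx N (k + 1)) = f k"
proof -
  have "(\<Sum>k=1..int N. f (pidx N (k + 1)) - f k) = 0"
    by (simp add: sum_subtractf sum_pidx_shift)
  then have "\<forall>k\<in>{1..int N}. f (pidx N (k + 1)) - f k = 0"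
    using assms(1) by (subst (asm) sum_nonneg_eq_0_iff) auto
  then show ?thesis using assms(2) by simp
qed

lemma sum_int_head:
  fixes f :: "int \<Rightarrow> real"
  assumes "N \<ge> 1"
  shows "(\<Sum>k=1..int N. f k) = f 1 + (\<Sum>k=1..int N - 1. f (k + 1))"
proof -
  have "{1..int N} = insert 1 {2..int N}" using assms by auto
  then have "(\<Sum>k=1..int N. f k) = f 1 + (\<Sum>k=2..int N. f k)" by simp
  also have "(\<Sum>k=2..int N. f k) = (\<Sum>k=1..int N - 1. f (k + 1))"
    by (rule sum.reindex_bij_witness[of _ "\<lambda>k. k + 1" "\<lambda>k. k - 1"]) auto
  finally show ?thesis .
qed

lemma sum_int_last:
  fixes f :: "int \<Rightarrow> real"
  assumes "N \<ge> 1"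
  shows "(\<Sum>k=1..int N. f k) = (\<Sum>k=1..int N - 1. f k) + f (int N)"
proof -
  have "{1..int N} = insert (int N) {1..int N - 1}" using assms by auto
  then show ?thesis by simp
qed

section \<open>The periodic and the open-end lattice\<close>

lemma periodic_closed:
  assumes "mu \<le> lam"
    and ok1: "Lam_ok Periodic N x xt lam"
    and ok2: "Lam_ok Periodic N xt xht mu"
    and ok3: "Lam_ok Periodic N x xh mu"
    and ok4: "Lam_ok Periodic N xh xht lam"
    and E: "\<And>k. 1 \<le> k \<Longrightarrow> k \<le> int N \<Longrightarrow>
      (exp (xt k - x k) - 1) * (lam + ExpD Periodic N x k xt (k - 1))
      = (exp (xh k - x k) - 1) * (mu + ExpD Periodic N x k xh (k - 1))"
    and E12: "\<And>k. 1 \<le> k \<Longrightarrow> k \<le> int N \<Longrightarrow>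
      (exp (xht k - xh k) - 1) * (lam + ExpD Periodic N xh (k + 1) xht k)
      = (exp (xht k - xt k) - 1) * (mu + ExpD Periodic N xt (k + 1) xht k)"
  shows "Lam Periodic N x xt lam + Lam Periodic N xt xht mu
    - Lam Periodic N x xh mu - Lam Periodic N xh xht lam = 0"
proof -
  let ?n = "\<lambda>k. pidx N (k + 1)"
  note step_ok = ok1[THEN Lam_ok_Periodic_psi_ok] ok2[THEN Lam_ok_Periodic_psi_ok]
    ok3[THEN Lam_ok_Periodic_psi_ok] ok4[THEN Lam_ok_Periodic_psi_ok]
  have le: "x k \<le> xt k" "xt k \<le> xht k" "x k \<le> xh k" "xh k \<le> xht k" if "k \<in> {1..int N}" for k
    using that by (auto intro: Lam_ok_le ok1 ok2 ok3 ok4)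
  have E': "(exp (xt (?n k) - x (?n k)) - 1) * (lam + exp (x (?n k) - xt k))
      = (exp (xh (?n k) - x (?n k)) - 1) * (mu + exp (x (?n k) - xh k))"
    and E12': "(exp (xht k - xh k) - 1) * (lam + exp (xh (?n k) - xht k))
      = (exp (xht k - xt k) - 1) * (mu + exp (xt (?n k) - xht k))"
    if "k \<in> {1..int N}" for k
    using E[of "?n k"] E12[of k] pidx_simps[of k N] that by (simp_all add: ExpD_def)
  show ?thesis
  proof (cases "mu > -1")
    case True
    obtain D where D: "\<And>x t h q t' h'. quad_ok lam mu x t h q t' h' \<Longrightarrow>
        quad_sum lam mu x t h q t' h' = D (t' - h') - D (t - h)"
      by (rule ex_quad_potential[OF \<open>mu \<le> lam\<close> True]) simp
    have quad: "quad_ok lam mu (x (?n k)) (xt (?n k)) (xh (?n k)) (xht k) (xt k) (xh k)"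
      if k: "k \<in> {1..int N}" for k
    proof -
      have "lam > -1" using True \<open>mu \<le> lam\<close> by simp
      moreover have "?n k \<in> {1..int N}"
        using k pidx_simps[of k N] by simp
      ultimately show ?thesis
        unfolding quad_ok_def using True k
        by (intro conjI psi_ok_pos step_ok E' E12' le)
    qed
    \<comment> \<open>The legs \<open>xt - x\<close> and \<open>xh - x\<close> are shifted by one
      site, which groups all terms into pairs \<open>(k, k + 1)\<close>.\<close>
    have "Lam Periodic N x xt lam + Lam Periodic N xt xht mu
        - Lam Periodic N x xh mu - Lam Periodic N xh xht lam
      = (\<Sum>k=1..int N. quad_sum lam mu (x (?n k)) (xt (?n k)) (xh (?n k)) (xht k) (xt k) (xh k))"
      using sum_pidx_shift[of "\<lambda>k. psi (xt k - x k) (-1)" N]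
        sum_pidx_shift[of "\<lambda>k. psi (xh k - x k) (-1)" N]
      by (simp add: Lam_def quad_sum_def sum.distrib sum_subtractf)
    also have "\<dots> = (\<Sum>k=1..int N. D (xt k - xh k) - D (xt (?n k) - xh (?n k)))"
      using quad by (intro sum.cong refl D)
    also have "\<dots> = 0"
      using sum_pidx_shift[of "\<lambda>k. D (xt k - xh k)" N] by (simp add: sum_subtractf)
    finally show ?thesis .
  next
    case False
    \<comment> \<open>For \<open>mu \<le> -1\<close> the logarithms are defined only for constant fields.\<close>
    have steps: "xh k \<le> x (?n k)" "xht k \<le> xt (?n k)" if "k \<in> {1..int N}" for k
      using step_ok(2,3)[OF that] False psi_ok_nonneg[of _ mu] by fastforce+
    have const: "x (?n k) = x k" "xt (?n k) = xt k" if "k \<in> {1..int N}" for k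
      by (rule pidx_increasing_imp_constant[OF _ that], blast intro: order_trans le steps)+
    have h: "xh k = x k" "xht k = xt k" if "k \<in> {1..int N}" for k
      using le[OF that] steps[OF that] const[OF that] by auto
    \<comment> \<open>The parameter \<open>lam\<close> may still exceed -1. In that case equation
      (E) at the next site has right-hand side 0, and its second factor on the left is
      positive.\<close>
    have "xt k = x k" if k: "k \<in> {1..int N}" for k
    proof (cases "lam > -1")
      case True
      have "?n k \<in> {1..int N}"
        using k pidx_simps[of k N] by simp
      then have "(exp (xt k - x k) - 1) * (lam + exp (x k - xt k)) = 0"
        using E'[OF k] h const k by simp
      moreover have "lam + exp (x k - xt k) > 0"
        using psi_ok_pos[OF step_ok(1)[OF k] True] const(1)[OF k] by simp
      ultimately show ?thesis by simp
    next
      case False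
      then have "xt k \<le> x (?n k)"
        using psi_ok_nonneg[OF step_ok(1)[OF k]] by simp
      then show ?thesis using le[OF k] const[OF k] by simp
    qed
    moreover have "xh (?n k) = x k" if "k \<in> {1..int N}" for k
      using h(1)[of "?n k"] const(1)[OF that] that pidx_simps[of k N] by simp
    ultimately show ?thesis
      using const h by (simp add: Lam_def)
  qed
qed

text \<open>The inner pairs telescope to a difference of \<open>D\<close> between the sites 1 and N,
  and the boundary pair, which joins N to 1, cancels it. Both parameters are positive here, as the
  terms with \<open>ln \<nu>\<close> demand.\<close>

lemma open_end_closed:
  assumes "N \<ge> 1" "mu \<le> lam"
    and ok1: "Lam_ok OpenEnd N x xt lam"
    and ok2: "Lam_ok OpenEnd N xt xht mu"
    and ok3: "Lam_ok OpenEnd N x xh mu"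
    and ok4: "Lam_ok OpenEnd N xh xht lam"
    and E: "\<And>k. 1 \<le> k \<Longrightarrow> k \<le> int N \<Longrightarrow>
      (exp (xt k - x k) - 1) * (lam + ExpD OpenEnd N x k xt (k - 1))
      = (exp (xh k - x k) - 1) * (mu + ExpD OpenEnd N x k xh (k - 1))"
    and E12: "\<And>k. 1 \<le> k \<Longrightarrow> k \<le> int N \<Longrightarrow>
      (exp (xht k - xh k) - 1) * (lam + ExpD OpenEnd N xh (k + 1) xht k)
      = (exp (xht k - xt k) - 1) * (mu + ExpD OpenEnd N xt (k + 1) xht k)"
  shows "Lam OpenEnd N x xt lam + Lam OpenEnd N xt xht mu
    - Lam OpenEnd N x xh mu - Lam OpenEnd N xh xht lam = 0"
proof -
  have "mu > 0" "lam > 0" using ok1 ok2 by (simp_all add: Lam_ok_def)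
  have le: "x k \<le> xt k" "xt k \<le> xht k" "x k \<le> xh k" "xh k \<le> xht k" if "k \<in> {1..int N}" for k
    using that by (auto intro: Lam_ok_le ok1 ok2 ok3 ok4)
  obtain D where D: "\<And>x t h q t' h'. quad_ok lam mu x t h q t' h' \<Longrightarrow>
        quad_sum lam mu x t h q t' h' = D (t' - h') - D (t - h)"
    and D_boundary: "\<And>x t h q t' h'. mu > 0 \<Longrightarrow> boundary_quad_ok lam mu x t h q t' h' \<Longrightarrow>
        boundary_quad_sum lam mu x t h q t' h' = D (t' - h') - D (t - h)"
    by (rule ex_quad_potential[OF \<open>mu \<le> lam\<close> less_trans[OF _ \<open>mu > 0\<close>]]) simp_all
  have quad: "quad_ok lam mu (x (k + 1)) (xt (k + 1)) (xh (k + 1)) (xht k) (xt k) (xh k)"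
    if k: "k \<in> {1..int N - 1}" for k
  proof -
    have "k \<in> {1..int N}" "k + 1 \<in> {1..int N}" using k by auto
    then show ?thesis
      unfolding quad_ok_def
      using le E[of "k + 1"] E12[of k] k \<open>lam > 0\<close> \<open>mu > 0\<close>
      by (auto simp: ExpD_def add_pos_pos)
  qed
  have boundary: "boundary_quad_ok lam mu (x 1) (xt 1) (xh 1) (xht (int N)) (xt (int N)) (xh (int N))"
    unfolding boundary_quad_ok_def
    using le[of 1] le[of "int N"] E[of 1] E12[of "int N"] \<open>N \<ge> 1\<close> by (simp add: ExpD_def)
  note head = sum_int_head[OF \<open>N \<ge> 1\<close>] and last = sum_int_last[OF \<open>N \<ge> 1\<close>]
  have "Lam OpenEnd N x xt lam + Lam OpenEnd N xt xht mu
      - Lam OpenEnd N x xh mu - Lam OpenEnd N xh xht lam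
    = (\<Sum>k=1..int N - 1. quad_sum lam mu (x (k + 1)) (xt (k + 1)) (xh (k + 1)) (xht k) (xt k) (xh k))
      + boundary_quad_sum lam mu (x 1) (xt 1) (xh 1) (xht (int N)) (xt (int N)) (xh (int N))"
    using head[of "\<lambda>k. psi (xt k - x k) (-1)"] head[of "\<lambda>k. psi (xh k - x k) (-1)"]
      last[of "\<lambda>k. psi (xht k - xt k) (-1)"] last[of "\<lambda>k. psi (xht k - xh k) (-1)"]
    by (simp add: Lam_def quad_sum_def boundary_quad_sum_def sum.distrib sum_subtractf)
  also have "\<dots> = (\<Sum>k=1..int N - 1. D (xt k - xh k) - D (xt (k + 1) - xh (k + 1)))
      + (D (xt (int N) - xh (int N)) - D (xt 1 - xh 1))"
    using D[OF quad] D_boundary[OF \<open>mu > 0\<close> boundary] by simp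
  also have "\<dots> = 0"
    using head[of "\<lambda>k. D (xt k - xh k)"] last[of "\<lambda>k. D (xt k - xh k)"]
    by (simp add: sum_subtractf)
  finally show ?thesis .
qed

lemma closed_if_ordered:
  assumes "N \<ge> 1" "mu \<le> lam"
    and "Lam_ok b N x xt lam" "Lam_ok b N xt xht mu" "Lam_ok b N x xh mu" "Lam_ok b N xh xht lam"
    and "\<And>k. 1 \<le> k \<Longrightarrow> k \<le> int N \<Longrightarrow>
      (exp (xt k - x k) - 1) * (lam + ExpD b N x k xt (k - 1))
      = (exp (xh k - x k) - 1) * (mu + ExpD b N x k xh (k - 1))"
    and "\<And>k. 1 \<le> k \<Longrightarrow> k \<le> int N \<Longrightarrow>
      (exp (xht k - xh k) - 1) * (lam + ExpD b N xh (k + 1) xht k)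
      = (exp (xht k - xt k) - 1) * (mu + ExpD b N xt (k + 1) xht k)"
  shows "Lam b N x xt lam + Lam b N xt xht mu - Lam b N x xh mu - Lam b N xh xht lam = 0"
proof (cases b)
  case Periodic
  show ?thesis
    by (rule periodic_closed[OF \<open>mu \<le> lam\<close> assms(3-8)[unfolded Periodic], folded Periodic])
next
  case OpenEnd
  show ?thesis
    by (rule open_end_closed[OF \<open>N \<ge> 1\<close> \<open>mu \<le> lam\<close> assms(3-8)[unfolded OpenEnd], folded OpenEnd])
qed

theorem theorem8:
  fixes b :: bc and N :: nat and lam mu :: real
    and x xt xh xht :: "int \<Rightarrow> real"
  assumes N: "N \<ge> 2"
    and ok1: "Lam_ok b N x xt lam"
    and ok2: "Lam_ok b N xt xht mu"
    and ok3: "Lam_ok b N x xh mu"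
    and ok4: "Lam_ok b N xh xht lam"
    and E: "\<And>k. 1 \<le> k \<Longrightarrow> k \<le> int N \<Longrightarrow>
      (exp (xt k - x k) - 1) * (lam + ExpD b N x k xt (k - 1))
      = (exp (xh k - x k) - 1) * (mu + ExpD b N x k xh (k - 1))"
    and E1: "\<And>k. 1 \<le> k \<Longrightarrow> k \<le> int N \<Longrightarrow>
      (exp (xt k - x k) - 1) * (lam + ExpD b N x (k + 1) xt k)
      = (exp (xht k - xt k) - 1) * (mu + ExpD b N xt k xht (k - 1))"
    and E2: "\<And>k. 1 \<le> k \<Longrightarrow> k \<le> int N \<Longrightarrow>
      (exp (xh k - x k) - 1) * (mu + ExpD b N x (k + 1) xh k)
      = (exp (xht k - xh k) - 1) * (lam + ExpD b N xh k xht (k - 1))"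
    and E12: "\<And>k. 1 \<le> k \<Longrightarrow> k \<le> int N \<Longrightarrow>
      (exp (xht k - xh k) - 1) * (lam + ExpD b N xh (k + 1) xht k)
      = (exp (xht k - xt k) - 1) * (mu + ExpD b N xt (k + 1) xht k)"
  shows "Lam b N x xt lam + Lam b N xt xht mu - Lam b N x xh mu - Lam b N xh xht lam = 0"
proof (cases "mu \<le> lam")
  case True
  have "N \<ge> 1" using N by simp
  from closed_if_ordered[OF this True ok1 ok2 ok3 ok4 E E12] show ?thesis .
next
  case False
  \<comment> \<open>Exchanging \<open>xt\<close>, \<open>lam\<close> with \<open>xh\<close>,
    \<open>mu\<close> swaps the sides of (E) and of (E12) and negates the closure relation.\<close>
  have "N \<ge> 1" "lam \<le> mu" using N False by simp_all
  from closed_if_ordered[OF this ok3 ok4 ok1 ok2 E[symmetric] E12[symmetric]] show ?thesis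
    by simp
qed

end
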